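(* Let $\mathfrak{B}$ be a Boolean contact algebra satisfying (IA) $x\ll y\to\exists z\,(x\ll z\ll y)$, (C5) $\forall x\neq\mathsf{0}\,\exists y\neq\mathsf{0}\; y\ll x$, and (C6) $x\notin\{\mathsf{0},\mathsf{1}\}\to x\mathrel{\mathsf{C}} -x$. Then $\mathbf{Q}_W^\omega\subseteq\mathbf{Q}_G\subseteq\mathbf{Q}_W$. If additionally $\mathfrak{B}$ satisfies the countable chain condition, then $\mathbf{Q}_W=\mathbf{Q}_G$.
   Context: A Boolean contact algebra is a Boolean algebra $\langle B,\cdot,+,-,\mathsf{0},\mathsf{1}\rangle$ with a relation $\mathsf{C}$ satisfying (C0) $\neg(\mathsf{0}\mathrel{\mathsf{C}} x)$; (C1) $x\leq y\wedge x\neq\mathsf{0}\to x\mathrel{\mathsf{C}} y$; (C2) symmetry; (C3) $x\leq y\to\forall z(z\mathrel{\mathsf{C}} x\to z\mathrel{\mathsf{C}} y)$; (C4) $x\mathrel{\mathsf{C}}(y+z)\to x\mathrel{\mathsf{C}} y\vee x\mathrel{\mathsf{C}} z$. $x\ll y$ iff $\neg(x\mathrel{\mathsf{C}} -y)$; $x\mathrel{\mathsf{O}} y$ iff $x\cdot y\neq\mathsf{0}$. For $X,Y\subseteq B$, $X\trianglelefteq Y$ means: for every $y\in Y$ there is $x\in X$ with $x\leq y$; coinitial means $X\trianglelefteq Y$ and $Y\trianglelefteq X$. $\mathbf{Q}_G$ is the set of G-representatives: non-empty $Q\subseteq B$ with (r0) $\mathsf{0}\notin Q$; (r1) for all $u,v\in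 Q$: $u=v$ or $u\ll v$ or $v\ll u$; (r2) for every $u\in Q$ there is $v\in Q$ with $v\ll u$; (r3) for all $x,y$: if $u\mathrel{\mathsf{O}} x$ and $u\mathrel{\mathsf{O}} y$ for all $u\in Q$ then $x\mathrel{\mathsf{C}} y$. An abstractive set is $A\subseteq B$ with (r0), (r1) and (A): no non-zero $x\in B$ has $x\leq y$ for all $y\in A$. $\mathbf{Q}_W$ is the set of W-representatives: abstractive sets $A$ such that for every abstractive set $D$, $D\trianglelefteq A$ implies $A\trianglelefteq D$. The coinitiality of a chain $C$ is the least cardinal $\kappa$ such that some antitone $f\colon\kappa\to C$ has $f[\kappa]$ coinitial with $C$; $\mathbf{Q}_W^\omega$ is the set of W-representatives of coinitiality $\omega$. The countable chain condition: every set of pairwise disjoint non-zero elements is countable.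
   Formalization: The algebra is additionally assumed to have an element other than 0 and 1; the claim fails otherwise: in the two-element algebra {1} is a G-representative but there are no W-representatives, and in the one-element algebra Q_G is empty while Q_W contains the empty set. *)

theory Defs
  imports Main "HOL-Library.Countable_Set"
begin

unbundle cardinal_syntax

locale boolean_contact_algebra =
  fixes C :: "'a::boolean_algebra \<Rightarrow> 'a \<Rightarrow> bool"
  assumes C0: "\<not> C bot x"
    and C1: "x \<le> y \<Longrightarrow> x \<noteq> bot \<Longrightarrow> C x y"
    and C2: "C x y \<Longrightarrow> C y x"
    and C3: "x \<le> y \<Longrightarrow> C z x \<Longrightarrow> C z y"
    and C4: "C x (sup y z) \<Longrightarrow> C x y \<or> C x z"

definition nontangential :: "('a::boolean_algebra \<Rightarrow> 'a \<Rightarrow> bool) \<Rightarrow> 'a \<Rightarrow> 'a \<Rightarrow> bool" where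
  "nontangential C x y \<longleftrightarrow> \<not> C x (- y)"

definition overlap :: "'a::boolean_algebra \<Rightarrow> 'a \<Rightarrow> bool" where
  "overlap x y \<longleftrightarrow> inf x y \<noteq> bot"

definition minorizes :: "'a::order set \<Rightarrow> 'a set \<Rightarrow> bool" where
  "minorizes X Y \<longleftrightarrow> (\<forall>y\<in>Y. \<exists>x\<in>X. x \<le> y)"

definition coinitial :: "'a::order set \<Rightarrow> 'a set \<Rightarrow> bool" where
  "coinitial X Y \<longleftrightarrow> minorizes X Y \<and> minorizes Y X"

definition r0 :: "'a::boolean_algebra set \<Rightarrow> bool" where
  "r0 Q \<longleftrightarrow> bot \<notin> Q"

definition r1 :: "('a::boolean_algebra \<Rightarrow> 'a \<Rightarrow> bool) \<Rightarrow> 'a set \<Rightarrow> bool" where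
  "r1 C Q \<longleftrightarrow> (\<forall>u\<in>Q. \<forall>v\<in>Q. u = v \<or> nontangential C u v \<or> nontangential C v u)"

definition r2 :: "('a::boolean_algebra \<Rightarrow> 'a \<Rightarrow> bool) \<Rightarrow> 'a set \<Rightarrow> bool" where
  "r2 C Q \<longleftrightarrow> (\<forall>u\<in>Q. \<exists>v\<in>Q. nontangential C v u)"

definition r3 :: "('a::boolean_algebra \<Rightarrow> 'a \<Rightarrow> bool) \<Rightarrow> 'a set \<Rightarrow> bool" where
  "r3 C Q \<longleftrightarrow> (\<forall>x y. (\<forall>u\<in>Q. overlap u x \<and> overlap u y) \<longrightarrow> C x y)"

definition Q_G :: "('a::boolean_algebra \<Rightarrow> 'a \<Rightarrow> bool) \<Rightarrow> 'a set set" where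
  "Q_G C = {Q. Q \<noteq> {} \<and> r0 Q \<and> r1 C Q \<and> r2 C Q \<and> r3 C Q}"

definition abstractive :: "('a::boolean_algebra \<Rightarrow> 'a \<Rightarrow> bool) \<Rightarrow> 'a set \<Rightarrow> bool" where
  "abstractive C A \<longleftrightarrow> r0 A \<and> r1 C A \<and> \<not> (\<exists>x. x \<noteq> bot \<and> (\<forall>y\<in>A. x \<le> y))"

definition Q_W :: "('a::boolean_algebra \<Rightarrow> 'a \<Rightarrow> bool) \<Rightarrow> 'a set set" where
  "Q_W C = {A. abstractive C A \<and>
     (\<forall>D. abstractive C D \<longrightarrow> minorizes D A \<longrightarrow> minorizes A D)}"

definition coinitial_map :: "'k rel \<Rightarrow> 'a::order set \<Rightarrow> ('k \<Rightarrow> 'a) \<Rightarrow> bool" where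
  "coinitial_map \<kappa> X f \<longleftrightarrow> f ` Field \<kappa> \<subseteq> X \<and>
     monotone_on (Field \<kappa>) (\<lambda>i j. (i, j) \<in> \<kappa>) (\<ge>) f \<and> coinitial (f ` Field \<kappa>) X"

text \<open>A cardinal is a relation satisfying \<^const>\<open>Card_order\<close>, compared by \<open>\<le>o\<close>. The competing
  cardinals may be taken on the same type \<open>'k\<close>: every cardinal smaller than \<open>\<kappa>\<close> is order-isomorphic
  to one whose field is a subset of the field of \<open>\<kappa>\<close>.\<close>

definition has_coinitiality :: "'a::order set \<Rightarrow> 'k rel \<Rightarrow> bool" where
  "has_coinitiality X \<kappa> \<longleftrightarrow> Card_order \<kappa> \<and> (\<exists>f. coinitial_map \<kappa> X f) \<and>
     (\<forall>\<mu> :: 'k rel. Card_order \<mu> \<and> (\<exists>f. coinitial_map \<mu> X f) \<longrightarrow> \<kappa> \<le>o \<mu>)"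

text \<open>The cardinal \<open>\<omega>\<close> is \<^const>\<open>natLeq\<close>.\<close>

definition Q_W_omega :: "('a::boolean_algebra \<Rightarrow> 'a \<Rightarrow> bool) \<Rightarrow> 'a set set" where
  "Q_W_omega C = {A \<in> Q_W C. has_coinitiality A natLeq}"

definition ccc :: "'a::boolean_algebra itself \<Rightarrow> bool" where
  "ccc _ \<longleftrightarrow> (\<forall>X :: 'a set. bot \<notin> X \<and> pairwise (\<lambda>x y. inf x y = bot) X \<longrightarrow> countable X)"

text \<open>The one-element and the two-element algebra satisfy (IA), (C5), (C6) and the countable chain
  condition, but the former has \<open>Q_G C \<noteq> Q_W C\<close> and the latter does not even have \<open>Q_G C \<subseteq> Q_W C\<close>.
  A comparison of \<^const>\<open>Q_G\<close> with \<^const>\<open>Q_W\<close> must therefore assume an element other than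
  \<^const>\<open>bot\<close> and \<^const>\<open>top\<close>.\<close>

lemma (in boolean_contact_algebra) one_element_algebra:
  assumes "(bot :: 'a) = top"
  shows "Q_G C = {}" and "Q_W C = {{}}"
proof -
  have x: "x = (bot :: 'a)" for x using assms by (metis bot.extremum_uniqueI top_greatest)
  have s: "bot \<notin> A \<longleftrightarrow> A = {}" for A :: "'a set" by (metis x all_not_in_conv)
  show "Q_G C = {}" using s by (auto simp: Q_G_def r0_def)
  show "Q_W C = {{}}"
    using s x by (auto simp: Q_W_def abstractive_def r0_def r1_def minorizes_def)
qed

lemma (in boolean_contact_algebra) two_element_algebra:
  assumes ne: "(bot :: 'a) \<noteq> top" and two: "\<And>x :: 'a. x = bot \<or> x = top"
  shows "{top} \<in> Q_G C" and "Q_W C = {}"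
proof -
  have t: "\<not> C top bot" using C0 C2 by blast
  have "C x y" if "overlap top x" "overlap top y" for x y
    using that two[of x] two[of y] C1[of top top] ne by (auto simp: overlap_def)
  then show "{top} \<in> Q_G C"
    using ne t by (auto simp: Q_G_def r0_def r1_def r2_def r3_def nontangential_def)
  have "\<not> abstractive C A" for A
    unfolding abstractive_def r0_def using two ne by (metis order_refl)
  then show "Q_W C = {}" by (auto simp: Q_W_def)
qed

end

(* For Q_G \<subseteq> Q_W: if D lies coinitially below a G-representative Q but no member of Q lies below
   some d \<in> D, pick d' \<in> D with d' \<lless> d. Every member of Q overlaps both d' and -d, so (r3) would
   put d' in contact with -d.

   For the converse, let A be a W-representative with a countable coinitial subset, so that some
   sequence b 0 \<ggreater> b 1 \<ggreater> ... in A is coinitial with A. If every member of A overlaps x and y but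
   x \<lless> -y, interpolate x \<lless> ... \<lless> v 1 \<lless> v 0 \<le> -y. The elements b n \<sqinter> v n form an abstractive
   set coinitially below A, so minimality of A gives a member of A below v 0 \<le> -y, which cannot
   overlap y.

   Under the countable chain condition a maximal disjoint family of differences a - b with
   b \<lless> a in A is countable, and the lower ends b of these gaps are coinitial with A. *)

theory Submission imports Defs
begin

context boolean_contact_algebra
begin

section \<open>Order properties of the well-inside relation\<close>

abbreviation well_inside :: "'a \<Rightarrow> 'a \<Rightarrow> bool" (infix "\<lless>" 50)
  where "x \<lless> y \<equiv> nontangential C x y"

text \<open>If \<open>x\<close> is not below \<open>y\<close>, then \<open>inf x (- y)\<close> is a
  non-zero part of both \<open>x\<close> and \<open>- y\<close>, and this common part puts them in
  contact.\<close>

lemma well_inside_le: "x \<lless> y \<Longrightarrow> x \<le> y"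
proof (rule ccontr)
  assume xy: "x \<lless> y" and "\<not> x \<le> y"
  then have "inf x (- y) \<noteq> bot"
    by (metis double_compl inf_shunt)
  then have "C (inf x (- y)) (- y)"
    using C1 by simp
  then have "C x (- y)"
    using C2[OF C3[OF inf_le1 C2]] by blast
  then show False
    using xy by (simp add: nontangential_def)
qed

lemma well_inside_mono: "x' \<le> x \<Longrightarrow> x \<lless> y \<Longrightarrow> y \<le> y' \<Longrightarrow> x' \<lless> y'"
  unfolding nontangential_def using C2 C3[of "- y'" "- y"] C3[of x' x] by (auto simp: compl_mono)

lemma well_inside_trans: "x \<lless> y \<Longrightarrow> y \<lless> z \<Longrightarrow> x \<lless> z"
  using well_inside_le well_inside_mono by blast

lemma well_inside_inf: "x \<lless> y \<Longrightarrow> x \<lless> z \<Longrightarrow> x \<lless> inf y z"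
  unfolding nontangential_def using C4 by (metis compl_inf)

text \<open>Equality and \<open>u \<lless> v\<close> both give \<open>u \<le> v\<close>. In this
  form a mere failure of \<open>u \<le> v\<close> already yields
  \<open>v \<lless> u\<close>.\<close>

lemma r1_le_cases:
  assumes "r1 C A" "u \<in> A" "v \<in> A"
  obtains "u \<le> v" | "v \<lless> u"
  using assms well_inside_le unfolding r1_def by (metis order_refl)

text \<open>The non-zero \<open>u\<close> cannot be a lower bound of \<open>A\<close>, so some
  member is not above it, and (r1) puts that member well inside \<open>u\<close>.\<close>

lemma abstractive_below:
  assumes "abstractive C A" "u \<in> A"
  obtains v where "v \<in> A" "v \<lless> u"
proof -
  have r1: "r1 C A" and "u \<noteq> bot"
    using assms by (auto simp: abstractive_def r0_def)
  then obtain v where "v \<in> A" "\<not> u \<le> v"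
    using assms by (auto simp: abstractive_def)
  then show thesis
    using r1_le_cases[OF r1 assms(2)] that by blast
qed

section \<open>G-representatives are W-representatives\<close>

text \<open>Below \<open>top\<close> any nontrivial element will do. For other \<open>x\<close>,
  (C6) says that \<open>x\<close> is not well inside itself, so the element supplied by (C5) is a
  proper part.\<close>

lemma not_atom:
  fixes x :: 'a
  assumes "\<exists>x :: 'a. x \<noteq> bot \<and> x \<noteq> top"
    and C5: "\<And>x. x \<noteq> bot \<Longrightarrow> \<exists>y. y \<noteq> bot \<and> y \<lless> x"
    and C6: "\<And>x. x \<notin> {bot, top} \<Longrightarrow> C x (- x)"
    and "x \<noteq> bot"
  obtains y where "y \<noteq> bot" "y < x"
proof (cases "x = top")
  case True
  then show thesis
    using assms(1) that top.not_eq_extremum by blast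
next
  case False
  obtain y where y: "y \<noteq> bot" "y \<lless> x"
    using C5 assms(4) by blast
  have "\<not> x \<lless> x"
    using C6 False assms(4) by (simp add: nontangential_def)
  then have "y < x"
    using y well_inside_le by (metis order.not_eq_order_implies_strict)
  then show thesis
    using that y by blast
qed

text \<open>A non-zero lower bound \<open>x\<close> of \<open>Q\<close> would contain some
  \<open>z \<lless> y < x\<close>. Members of \<open>Q\<close> lie above \<open>z\<close> and are
  not below \<open>y\<close>, so they overlap \<open>z\<close> and \<open>- y\<close>, and (r3)
  would put these in contact.\<close>

lemma Q_G_abstractive:
  assumes "\<exists>x :: 'a. x \<noteq> bot \<and> x \<noteq> top"
    and C5: "\<And>x. x \<noteq> bot \<Longrightarrow> \<exists>y. y \<noteq> bot \<and> y \<lless> x"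
    and C6: "\<And>x. x \<notin> {bot, top} \<Longrightarrow> C x (- x)"
    and Q: "Q \<in> Q_G C"
  shows "abstractive C Q"
  unfolding abstractive_def
proof (intro conjI notI)
  show "r0 Q" "r1 C Q"
    using Q by (auto simp: Q_G_def)
  assume "\<exists>x. x \<noteq> bot \<and> (\<forall>u\<in>Q. x \<le> u)"
  then obtain x where x: "x \<noteq> bot" "\<And>u. u \<in> Q \<Longrightarrow> x \<le> u"
    by blast
  obtain y where y: "y \<noteq> bot" "y < x"
    using not_atom[OF assms(1) C5 C6 x(1)] by blast
  obtain z where z: "z \<noteq> bot" "z \<lless> y"
    using C5 y(1) by blast
  have "overlap u z \<and> overlap u (- y)" if "u \<in> Q" for u
  proof
    have "z \<le> u"
      using x(2)[OF that] y(2) well_inside_le[OF z(2)] by order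
    then show "overlap u z"
      using z(1) by (simp add: overlap_def inf_absorb2)
    have "\<not> u \<le> y"
      using x(2)[OF that] y(2) by order
    then show "overlap u (- y)"
      by (simp add: overlap_def inf_shunt)
  qed
  then have "C z (- y)"
    using Q by (simp add: Q_G_def r3_def)
  then show False
    using z(2) by (simp add: nontangential_def)
qed

lemma Q_G_minorizes:
  assumes Q: "Q \<in> Q_G C" and D: "abstractive C D" and DQ: "minorizes D Q"
  shows "minorizes Q D"
  unfolding minorizes_def
proof (intro ballI, rule ccontr)
  fix d assume d: "d \<in> D" and no: "\<not> (\<exists>q\<in>Q. q \<le> d)"
  have r1: "r1 C D" and r0: "bot \<notin> D"
    using D by (auto simp: abstractive_def r0_def)
  obtain d' where d': "d' \<in> D" "d' \<lless> d"
    using abstractive_below[OF D d] by blast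
  have "overlap q d' \<and> overlap q (- d)" if q: "q \<in> Q" for q
  proof
    obtain e where e: "e \<in> D" "e \<le> q"
      using DQ q by (auto simp: minorizes_def)
    \<comment> \<open>\<open>D\<close> is a chain, so this meet is the smaller of two members of
      \<open>D\<close> and hence non-zero.\<close>
    have "inf e d' = e \<or> inf e d' = d'"
      using r1_le_cases[OF r1 e(1) d'(1)] well_inside_le inf_absorb1 inf_absorb2 by metis
    then have "inf e d' \<noteq> bot"
      using e(1) d'(1) r0 by auto
    then show "overlap q d'"
      unfolding overlap_def using e(2) by (metis inf_mono order_refl bot.extremum_uniqueI)
    show "overlap q (- d)"
      using no q by (auto simp: overlap_def inf_shunt)
  qed
  then have "C d' (- d)"
    using Q by (simp add: Q_G_def r3_def)
  then show False
    using d'(2) by (simp add: nontangential_def)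
qed

lemma Q_G_subset_Q_W:
  assumes "\<exists>x :: 'a. x \<noteq> bot \<and> x \<noteq> top"
    and "\<And>x. x \<noteq> bot \<Longrightarrow> \<exists>y. y \<noteq> bot \<and> y \<lless> x"
    and "\<And>x. x \<notin> {bot, top} \<Longrightarrow> C x (- x)"
  shows "Q_G C \<subseteq> Q_W C"
proof
  fix Q assume Q: "Q \<in> Q_G C"
  show "Q \<in> Q_W C"
    using Q_G_abstractive[OF assms Q] Q_G_minorizes[OF Q] by (simp add: Q_W_def)
qed

section \<open>W-representatives with a countable coinitial subset\<close>

lemma abstractive_coinitial_sequence:
  assumes A: "abstractive C A"
    and S: "S \<subseteq> A" "countable S" "S \<noteq> {}" "minorizes S A"
  obtains b :: "nat \<Rightarrow> 'a"
  where "\<And>n. b n \<in> A" "\<And>n. b (Suc n) \<lless> b n" "minorizes (range b) A"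
proof -
  define g where "g = from_nat_into S"
  have g: "range g = S"
    using S by (simp add: g_def range_from_nat_into)
  have r1: "r1 C A"
    using A by (simp add: abstractive_def)
  have step: "\<exists>w. w \<in> A \<and> w \<lless> u \<and> w \<le> g n" if u: "u \<in> A" for u n
  proof -
    have gA: "g n \<in> A"
      using g S(1) by blast
    \<comment> \<open>The smaller of \<open>u\<close> and \<open>g n\<close> serves; an element well
      inside it continues the sequence and also gets below the \<open>n\<close>-th element of the
      enumeration of \<open>S\<close>.\<close>
    have "\<exists>m\<in>A. m \<le> u \<and> m \<le> g n"
      using r1_le_cases[OF r1 u gA] u gA well_inside_le by (metis order_refl)
    then obtain m where m: "m \<in> A" "m \<le> u" "m \<le> g n"
      by blast
    obtain w where w: "w \<in> A" "w \<lless> m"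
      using abstractive_below[OF A m(1)] by blast
    have "w \<lless> u"
      using well_inside_mono[OF order_refl w(2) m(2)] .
    moreover have "w \<le> g n"
      using well_inside_le[OF w(2)] m(3) by order
    ultimately show ?thesis
      using w(1) by blast
  qed
  have "\<exists>b. \<forall>n. b n \<in> A \<and> (b (Suc n) \<lless> b n \<and> b (Suc n) \<le> g n)"
  proof (rule dependent_nat_choice)
    show "\<exists>u. u \<in> A"
      using S by blast
  qed (use step in blast)
  then obtain b where b: "\<And>n. b n \<in> A" "\<And>n. b (Suc n) \<lless> b n" "\<And>n. b (Suc n) \<le> g n"
    by blast
  have "minorizes (range b) A"
    unfolding minorizes_def
  proof
    fix a assume "a \<in> A"
    then obtain n where "g n \<le> a"
      using S(4) g by (auto simp: minorizes_def)
    then show "\<exists>w\<in>range b. w \<le> a"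
      using b(3)[of n] order_trans by blast
  qed
  then show thesis
    using that b by blast
qed

text \<open>Each new term is interpolated by (IA) between \<open>x\<close> and the term before
  it.\<close>

lemma interpolating_sequence:
  assumes IA: "\<And>x y. x \<lless> y \<Longrightarrow> \<exists>z. x \<lless> z \<and> z \<lless> y"
    and "x \<lless> y"
  obtains v :: "nat \<Rightarrow> 'a" where "\<And>n. x \<lless> v n" "\<And>n. v (Suc n) \<lless> v n" "\<And>n. v n \<le> y"
proof -
  have "\<exists>v. \<forall>n. (x \<lless> v n \<and> v n \<le> y) \<and> v (Suc n) \<lless> v n"
  proof (rule dependent_nat_choice)
    show "\<exists>z. x \<lless> z \<and> z \<le> y"
      using IA[OF assms(2)] well_inside_le by blast
  next
    fix z and n :: nat assume "x \<lless> z \<and> z \<le> y"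
    then show "\<exists>w. (x \<lless> w \<and> w \<le> y) \<and> w \<lless> z"
      using IA[of x z] well_inside_le order_trans by blast
  qed
  then show thesis
    using that by blast
qed

lemma Q_W_imp_Q_G:
  assumes IA: "\<And>x y. x \<lless> y \<Longrightarrow> \<exists>z. x \<lless> z \<and> z \<lless> y"
    and A: "A \<in> Q_W C"
    and S: "S \<subseteq> A" "countable S" "S \<noteq> {}" "minorizes S A"
  shows "A \<in> Q_G C"
proof -
  have abs: "abstractive C A"
    and min: "\<And>D. abstractive C D \<Longrightarrow> minorizes D A \<Longrightarrow> minorizes A D"
    using A by (auto simp: Q_W_def)
  have "C x y" if ov: "\<forall>u\<in>A. overlap u x \<and> overlap u y" for x y
  proof (rule ccontr)
    assume "\<not> C x y"
    then have "x \<lless> - y"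
      by (simp add: nontangential_def)
    then obtain v :: "nat \<Rightarrow> 'a"
      where v: "\<And>n. x \<lless> v n" "\<And>n. v (Suc n) \<lless> v n" "\<And>n. v n \<le> - y"
      using interpolating_sequence[OF IA] by blast
    obtain b :: "nat \<Rightarrow> 'a"
      where b: "\<And>n. b n \<in> A" "\<And>n. b (Suc n) \<lless> b n" "minorizes (range b) A"
      using abstractive_coinitial_sequence[OF abs S] by blast
    define d where "d n = inf (b n) (v n)" for n
    have d_step: "d (Suc n) \<lless> d n" for n
      unfolding d_def
      using b(2) v(2) by (meson inf_le1 inf_le2 order_refl well_inside_inf well_inside_mono)
    have d_less: "d n \<lless> d m" if "m < n" for m n
      using that
    proof (induction rule: less_Suc_induct)
      case (1 i)
      show ?case by (rule d_step)
    next
      case (2 i j k)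
      then show ?case using well_inside_trans by blast
    qed
    \<comment> \<open>All \<open>v n\<close> lie above \<open>x\<close>, so \<open>d n\<close>
      contains the part of \<open>x\<close> inside \<open>b n\<close>, which is non-zero as every
      member of \<open>A\<close> overlaps \<open>x\<close>.\<close>
    have d_ne: "d n \<noteq> bot" for n
    proof -
      have "inf (b n) x \<noteq> bot"
        using ov b(1) by (simp add: overlap_def)
      moreover have "inf (b n) x \<le> d n"
        unfolding d_def using well_inside_le[OF v(1)] by (intro inf_mono) auto
      ultimately show ?thesis
        using bot.extremum_uniqueI by metis
    qed
    have dA: "minorizes (range d) A"
      using b(3) unfolding minorizes_def d_def by (fastforce intro: order_trans[OF inf_le1])
    have "abstractive C (range d)"
      unfolding abstractive_def r0_def r1_def
    proof (intro conjI notI ballI)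
      assume "bot \<in> range d"
      then show False
        using d_ne by (metis rangeE)
    next
      fix s t assume "s \<in> range d" "t \<in> range d"
      then show "s = t \<or> s \<lless> t \<or> t \<lless> s"
        using d_less by (metis nat_neq_iff rangeE)
    next
      assume "\<exists>z. z \<noteq> bot \<and> (\<forall>s\<in>range d. z \<le> s)"
      \<comment> \<open>A lower bound of the \<open>d n\<close> is one of \<open>A\<close>, since
        below each member of \<open>A\<close> there is some \<open>d n\<close>.\<close>
      then have "\<exists>z. z \<noteq> bot \<and> (\<forall>a\<in>A. z \<le> a)"
        using dA unfolding minorizes_def by (meson order_trans)
      then show False
        using abs by (simp add: abstractive_def)
    qed
    then have "minorizes A (range d)"
      using min dA by blast
    then obtain a where a: "a \<in> A" "a \<le> d 0"
      by (auto simp: minorizes_def)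
    then have "a \<le> - y"
      using v(3)[of 0] by (auto simp: d_def intro: order_trans)
    then have "\<not> overlap a y"
      by (simp add: overlap_def inf_shunt)
    then show False
      using ov a(1) by blast
  qed
  then have "r3 C A"
    by (simp add: r3_def)
  moreover have "r2 C A"
    unfolding r2_def using abstractive_below[OF abs] by blast
  ultimately show ?thesis
    using abs S by (auto simp: Q_G_def abstractive_def)
qed

section \<open>Countable coinitial subsets from the countable chain condition\<close>

lemma ccc_countable_coinitial:
  assumes ccc: "ccc TYPE('a)" and A: "abstractive C A"
  obtains S where "S \<subseteq> A" "countable S" "minorizes S A"
proof -
  \<comment> \<open>By (r1), \<open>\<not> a \<le> b\<close> forces \<open>b \<lless> a\<close>; it
    also makes the difference non-zero.\<close>
  define gaps where "gaps = {inf a (- b) | a b. a \<in> A \<and> b \<in> A \<and> \<not> a \<le> b}"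
  define F where "F = {M. M \<subseteq> gaps \<and> pairwise (\<lambda>x y. inf x y = bot) M}"
  have gap_ne: "g \<noteq> bot" if "g \<in> gaps" for g
    using that by (auto simp: gaps_def inf_shunt)
  have "\<exists>M\<in>F. \<forall>X\<in>F. M \<subseteq> X \<longrightarrow> X = M"
  proof (rule subset_Zorn_nonempty)
    have "{} \<in> F"
      by (simp add: F_def)
    then show "F \<noteq> {}"
      by blast
    fix \<C> assume "\<C> \<noteq> {}" and "subset.chain F \<C>"
    then have sub: "\<C> \<subseteq> F" and chain: "chain\<^sub>\<subseteq> \<C>"
      by (auto simp: subset_chain_def chain_subset_def)
    have "pairwise (\<lambda>x y. inf x y = bot) (\<Union>\<C>)"
      using sub chain by (intro pairwise_chain_Union) (auto simp: F_def)
    then show "\<Union>\<C> \<in> F"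
      using sub by (auto simp: F_def)
  qed
  then obtain M where M: "M \<subseteq> gaps" "pairwise (\<lambda>x y. inf x y = bot) M"
    and max: "\<And>X. X \<subseteq> gaps \<Longrightarrow> pairwise (\<lambda>x y. inf x y = bot) X \<Longrightarrow> M \<subseteq> X \<Longrightarrow> X = M"
    by (auto simp: F_def)
  have "countable M"
    using ccc M gap_ne unfolding ccc_def by blast
  have "\<forall>g\<in>M. \<exists>b\<in>A. g \<le> - b"
  proof
    fix g assume "g \<in> M"
    then obtain a b where "b \<in> A" "g = inf a (- b)"
      using M(1) by (auto simp: gaps_def)
    then show "\<exists>b\<in>A. g \<le> - b"
      using inf_le2 by blast
  qed
  then obtain l where l: "\<And>g. g \<in> M \<Longrightarrow> l g \<in> A" "\<And>g. g \<in> M \<Longrightarrow> g \<le> - l g"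
    by metis
  have r1: "r1 C A"
    using A by (simp add: abstractive_def)
  have "minorizes (l ` M) A"
    unfolding minorizes_def
  proof (intro ballI, rule ccontr)
    fix a assume a: "a \<in> A" and no: "\<not> (\<exists>s\<in>l ` M. s \<le> a)"
    have "a \<noteq> bot"
      using A a by (auto simp: abstractive_def r0_def)
    then obtain b where b: "b \<in> A" "\<not> a \<le> b"
      using A by (auto simp: abstractive_def)
    define g where "g = inf a (- b)"
    have g: "g \<in> gaps"
      using a b by (auto simp: g_def gaps_def)
    have disj: "inf g h = bot" if h: "h \<in> M" for h
    proof -
      \<comment> \<open>No chosen lower end is below \<open>a\<close>, so all of them are above
        \<open>a\<close>. Thus \<open>g\<close> lies below \<open>l h\<close> and \<open>h\<close>
        below its complement.\<close>
      have "a \<le> l h"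
        using r1_le_cases[OF r1 l(1)[OF h] a] no h well_inside_le by blast
      then have "g \<le> l h"
        by (auto simp: g_def intro: order_trans[OF inf_le1])
      then show ?thesis
        using inf_mono[OF _ l(2)[OF h], of g "l h"] by (simp add: bot_unique)
    qed
    have "pairwise (\<lambda>x y. inf x y = bot) (insert g M)"
      using M(2) disj by (auto simp: pairwise_insert inf_commute)
    then have "insert g M = M"
      using max g M(1) by blast
    \<comment> \<open>Maximality puts \<open>g\<close> into \<open>M\<close>, so \<open>g\<close> is
      disjoint from itself.\<close>
    then have "inf g g = bot"
      using disj by blast
    then show False
      using gap_ne[OF g] by simp
  qed
  then show thesis
    using that[of "l ` M"] l(1) \<open>countable M\<close> by blast
qed

end

theorem theorem5p4:
  fixes C :: "'a::boolean_algebra \<Rightarrow> 'a \<Rightarrow> bool"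
  assumes "boolean_contact_algebra C"
    and nontrivial: "\<exists>x :: 'a. x \<noteq> bot \<and> x \<noteq> top"
    and IA: "\<And>x y. nontangential C x y \<Longrightarrow> \<exists>z. nontangential C x z \<and> nontangential C z y"
    and C5: "\<And>x. x \<noteq> bot \<Longrightarrow> \<exists>y. y \<noteq> bot \<and> nontangential C y x"
    and C6: "\<And>x. x \<notin> {bot, top} \<Longrightarrow> C x (- x)"
  shows "Q_W_omega C \<subseteq> Q_G C \<and> Q_G C \<subseteq> Q_W C \<and> (ccc TYPE('a) \<longrightarrow> Q_W C = Q_G C)"
proof (intro conjI impI)
  interpret boolean_contact_algebra C by fact
  show GW: "Q_G C \<subseteq> Q_W C"
    using Q_G_subset_Q_W[OF nontrivial C5 C6] .
  show "Q_W_omega C \<subseteq> Q_G C"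
  proof
    fix A assume "A \<in> Q_W_omega C"
    then obtain f :: "nat \<Rightarrow> 'a" where A: "A \<in> Q_W C" and f: "coinitial_map natLeq A f"
      by (auto simp: Q_W_omega_def has_coinitiality_def)
    show "A \<in> Q_G C"
      using f by (intro Q_W_imp_Q_G[OF IA A, of "range f"])
        (auto simp: coinitial_map_def coinitial_def Field_natLeq)
  qed
  show "Q_W C = Q_G C" if ccc: "ccc TYPE('a)"
  proof
    show "Q_W C \<subseteq> Q_G C"
    proof
      fix A assume A: "A \<in> Q_W C"
      then have abs: "abstractive C A"
        by (simp add: Q_W_def)
      \<comment> \<open>Every element is a lower bound of the empty set, and a non-zero one
        exists.\<close>
      then have "A \<noteq> {}"
        using nontrivial by (auto simp: abstractive_def)
      obtain S where S: "S \<subseteq> A" "countable S" "minorizes S A"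
        using ccc_countable_coinitial[OF ccc abs] by blast
      then have "S \<noteq> {}"
        using \<open>A \<noteq> {}\<close> by (auto simp: minorizes_def)
      then show "A \<in> Q_G C"
        using Q_W_imp_Q_G[OF IA A] S by blast
    qed
  qed (rule GW)
qed

end
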